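(* Every irreducible finite loopless multigraph $G$ has a regular embedding into some Euclidean space $\mathbb{R}^k$, i.e. there exist $k$ and a map $f:V(G)\to\mathbb{R}^k$ such that $\mathrm{Aut}(G)$ is isomorphic to the group of isometries of $\mathbb{R}^k$ mapping $f(V(G))$ onto itself.
   Context: $\mu(x,y)$ is the number of edges with endpoints $x,y$. Distinct vertices $x,y$ are twins if $\mu(x,v)=\mu(y,v)$ for all $v\in V(G)\setminus\{x,y\}$; $G$ is irreducible if it has no twins. $\mathrm{Aut}(G)$ is the group of bijections $g$ of $V(G)$ with $\mu(g(x),g(y))=\mu(x,y)$ for all $x,y$. *)

theory Defs
  imports "HOL-Analysis.Analysis" "HOL-Algebra.Bij"
begin

section \<open>Multigraphs\<close>

record ('v, 'e) multigraph =
  verts :: "'v set"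
  edges :: "'e set"
  ends :: "'e \<Rightarrow> 'v set"

text \<open>An edge carries the set of its endpoints; a loop is an edge with a single endpoint.\<close>

locale multigraph =
  fixes G :: "('v, 'e) multigraph"
  assumes ends_subset: "e \<in> edges G \<Longrightarrow> ends G e \<subseteq> verts G"
    and card_ends: "e \<in> edges G \<Longrightarrow> card (ends G e) \<in> {1, 2}"

locale finite_multigraph = multigraph +
  assumes finite_verts: "finite (verts G)"
    and finite_edges: "finite (edges G)"

definition loopless :: "('v, 'e) multigraph \<Rightarrow> bool" where
  "loopless G \<longleftrightarrow> (\<forall>e\<in>edges G. card (ends G e) \<noteq> 1)"

definition edge_mult :: "('v, 'e) multigraph \<Rightarrow> 'v \<Rightarrow> 'v \<Rightarrow> nat" where
  "edge_mult G x y = card {e \<in> edges G. ends G e = {x, y}}"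

definition twins :: "('v, 'e) multigraph \<Rightarrow> 'v \<Rightarrow> 'v \<Rightarrow> bool" where
  "twins G x y \<longleftrightarrow> x \<in> verts G \<and> y \<in> verts G \<and> x \<noteq> y \<and>
     (\<forall>v\<in>verts G - {x, y}. edge_mult G x v = edge_mult G y v)"

definition irreducible_multigraph :: "('v, 'e) multigraph \<Rightarrow> bool" where
  "irreducible_multigraph G \<longleftrightarrow> \<not> (\<exists>x y. twins G x y)"

definition Aut :: "('v, 'e) multigraph \<Rightarrow> ('v \<Rightarrow> 'v) monoid" where
  "Aut G = BijGroup (verts G)
     \<lparr>carrier := {g \<in> Bij (verts G).
        \<forall>x\<in>verts G. \<forall>y\<in>verts G. edge_mult G (g x) (g y) = edge_mult G x y}\<rparr>"


section \<open>Isometries of Euclidean space\<close>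

text \<open>
  The points of \<open>\<real>\<^sup>k\<close> are the functions vanishing outside \<open>{..<k}\<close>.  The dimension is a
  natural number rather than a type because \<open>k\<close> is existentially quantified in the theorem and
  \<open>k = 0\<close> must be allowed: for a graph with at most one vertex no larger \<open>k\<close> works.
\<close>

abbreviation Rpow :: "nat \<Rightarrow> (nat \<Rightarrow> real) set" where
  "Rpow k \<equiv> topspace (Euclidean_space k)"

definition Rdist :: "nat \<Rightarrow> (nat \<Rightarrow> real) \<Rightarrow> (nat \<Rightarrow> real) \<Rightarrow> real" where
  "Rdist k x y = L2_set (\<lambda>i. x i - y i) {..<k}"

definition isometries :: "nat \<Rightarrow> ((nat \<Rightarrow> real) \<Rightarrow> (nat \<Rightarrow> real)) set" where
  "isometries k = {g \<in> Bij (Rpow k). \<forall>x\<in>Rpow k. \<forall>y\<in>Rpow k. Rdist k (g x) (g y) = Rdist k x y}"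

definition setwise_isometry_group ::
    "nat \<Rightarrow> (nat \<Rightarrow> real) set \<Rightarrow> ((nat \<Rightarrow> real) \<Rightarrow> (nat \<Rightarrow> real)) monoid" where
  "setwise_isometry_group k S = BijGroup (Rpow k) \<lparr>carrier := {g \<in> isometries k. g ` S = S}\<rparr>"

definition regular_embedding ::
    "('v, 'e) multigraph \<Rightarrow> nat \<Rightarrow> ('v \<Rightarrow> nat \<Rightarrow> real) \<Rightarrow> bool" where
  "regular_embedding G k f \<longleftrightarrow>
     f \<in> verts G \<rightarrow> Rpow k \<and> Aut G \<cong> setwise_isometry_group k (f ` verts G)"


section \<open>Both structures are groups\<close>

lemma subgroup_BijGroupI:
  assumes sub: "H \<subseteq> Bij S"
    and id: "(\<lambda>x\<in>S. x) \<in> H"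
    and comp: "\<And>g h. g \<in> H \<Longrightarrow> h \<in> H \<Longrightarrow> compose S g h \<in> H"
    and inv: "\<And>g. g \<in> H \<Longrightarrow> (\<lambda>x\<in>S. inv_into S g x) \<in> H"
  shows "subgroup H (BijGroup S)"
proof (rule subgroup.intro)
  show "H \<subseteq> carrier (BijGroup S)"
    using sub by (simp add: BijGroup_def)
  show "\<one>\<^bsub>BijGroup S\<^esub> \<in> H"
    using id by (simp add: BijGroup_def)
  show "g \<otimes>\<^bsub>BijGroup S\<^esub> h \<in> H" if "g \<in> H" "h \<in> H" for g h
    using that sub comp by (auto simp: BijGroup_def subset_iff)
  show "inv\<^bsub>BijGroup S\<^esub> g \<in> H" if "g \<in> H" for g
    using that sub inv by (auto simp: inv_BijGroup subset_iff)
qed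

lemma Bij_inv_into_cong:
  assumes g: "g \<in> Bij S"
    and pres: "\<And>x y. x \<in> S \<Longrightarrow> y \<in> S \<Longrightarrow> d (g x) (g y) = d x y"
    and xy: "x \<in> S" "y \<in> S"
  shows "d (inv_into S g x) (inv_into S g y) = d x y"
proof -
  have im: "g ` S = S"
    using g by (simp add: Bij_def bij_betw_def)
  have "d (g (inv_into S g x)) (g (inv_into S g y)) = d (inv_into S g x) (inv_into S g y)"
    by (rule pres) (use g xy Bij_inv_into_mem in fast)+
  then show ?thesis
    using xy im by (simp add: f_inv_into_f)
qed

lemma image_restrict_subset: "T \<subseteq> S \<Longrightarrow> restrict g S ` T = g ` T"
  by (intro image_cong) auto

lemma Bij_mem: "g \<in> Bij S \<Longrightarrow> x \<in> S \<Longrightarrow> g x \<in> S"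
  by (rule funcset_mem[OF Bij_imp_funcset])

lemma group_Aut: "group (Aut G)"
  unfolding Aut_def
  by (rule subgroup.subgroup_is_group[OF subgroup_BijGroupI group_BijGroup])
    (auto simp: id_Bij compose_Bij restrict_inv_into_Bij Bij_inv_into_cong compose_eq
      Bij_mem)

lemma group_setwise_isometry_group:
  assumes "S \<subseteq> Rpow k"
  shows "group (setwise_isometry_group k S)"
  unfolding setwise_isometry_group_def
proof (rule subgroup.subgroup_is_group[OF subgroup_BijGroupI group_BijGroup])
  fix g assume g: "g \<in> {g \<in> isometries k. g ` S = S}"
  then have B: "g \<in> Bij (Rpow k)" and inj: "inj_on g (Rpow k)" and gS: "g ` S = S"
    by (auto simp: isometries_def Bij_def bij_betw_def)
  have "inv_into (Rpow k) g ` S = inv_into (Rpow k) g ` (g ` S)"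
    by (simp add: gS)
  also have "\<dots> = S"
    using inj assms by (rule inv_into_image_cancel)
  finally have "(\<lambda>x\<in>Rpow k. inv_into (Rpow k) g x) ` S = S"
    by (simp only: image_restrict_subset[OF assms])
  then show "(\<lambda>x\<in>Rpow k. inv_into (Rpow k) g x) \<in> {g \<in> isometries k. g ` S = S}"
    using g by (auto simp: isometries_def restrict_inv_into_Bij Bij_inv_into_cong)
next
  fix g h assume gh: "g \<in> {g \<in> isometries k. g ` S = S}" "h \<in> {g \<in> isometries k. g ` S = S}"
  have "compose (Rpow k) g h ` S = (\<lambda>x. g (h x)) ` S"
    using assms by (intro image_cong) (auto simp: compose_eq)
  also have "\<dots> = S"
    using gh by (simp flip: image_image)
  finally show "compose (Rpow k) g h \<in> {g \<in> isometries k. g ` S = S}"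
    using gh by (auto simp: isometries_def compose_Bij compose_eq Bij_mem)
qed (use assms in \<open>auto simp: isometries_def id_Bij image_restrict_subset\<close>)

end

(* Perturb a regular simplex with n vertices in dimension n - 1 so that the squared distance between
   the points of v and w becomes 1 + eps * mu(v, w); for small eps the Gram matrix stays positive
   definite, so such points exist and affinely span the space. An isometry preserving the point set
   is determined by the permutation that it induces. Conversely, a permutation of the points comes
   from an isometry (act on barycentric coordinates) iff it preserves the distances, that is,
   iff it preserves mu. The dimension n - 1 matters: in a larger space the isometries fixing all
   points form a nontrivial group. *)
theory Submission
  imports Defs
begin

section \<open>Points and distances in coordinates\<close>

lemma Rpow_iff: "x \<in> Rpow k \<longleftrightarrow> (\<forall>i\<ge>k. x i = 0)"
  by (simp add: topspace_Euclidean_space)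

lemma Rdist_power2: "(Rdist k x y)\<^sup>2 = (\<Sum>i<k. (x i - y i)\<^sup>2)"
  by (simp add: Rdist_def L2_set_def sum_nonneg)

lemma Rdist_nonneg: "Rdist k x y \<ge> 0"
  by (simp add: Rdist_def)

lemma Rdist_eq_iff: "Rdist k x y = Rdist l u v \<longleftrightarrow> (Rdist k x y)\<^sup>2 = (Rdist l u v)\<^sup>2"
  by (simp add: Rdist_nonneg power2_eq_iff_nonneg)

lemma Rdist_self [simp]: "Rdist k x x = 0"
  by (simp add: Rdist_def L2_set_def)

lemma Rdist_eq_0_imp_eq:
  assumes "x \<in> Rpow k" "y \<in> Rpow k" "Rdist k x y = 0"
  shows "x = y"
proof
  fix i
  have "\<forall>i<k. x i = y i"
    using assms(3) by (auto simp: Rdist_def L2_set_eq_0_iff)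
  then show "x i = y i"
    using assms(1,2) unfolding Rpow_iff by (cases "i < k") auto
qed


section \<open>Barycentric coordinates\<close>

text \<open>The weights are unrestricted because three cases occur: sum 1 for points of the affine
  hull, sum 0 for differences of such points, and arbitrary weights for the linear span.\<close>

definition combination :: "'v set \<Rightarrow> ('v \<Rightarrow> real) \<Rightarrow> ('v \<Rightarrow> nat \<Rightarrow> real) \<Rightarrow> nat \<Rightarrow> real" where
  "combination V c p = (\<lambda>i. \<Sum>v\<in>V. c v * p v i)"

text \<open>Affine spanning only: barycentric coordinates exist, but their uniqueness is not built
  in, so a map defined through them has to be shown independent of the choice.\<close>

definition affine_frame :: "nat \<Rightarrow> 'v set \<Rightarrow> ('v \<Rightarrow> nat \<Rightarrow> real) \<Rightarrow> bool" where
  "affine_frame k V p \<longleftrightarrow> finite V \<and> p \<in> V \<rightarrow> Rpow k \<and>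
     (\<forall>x\<in>Rpow k. \<exists>c. sum c V = 1 \<and> x = combination V c p)"

lemma combination_in_Rpow: "p \<in> V \<rightarrow> Rpow k \<Longrightarrow> combination V c p \<in> Rpow k"
  unfolding Rpow_iff combination_def Pi_iff by (auto intro!: sum.neutral)

lemma combination_single:
  "finite V \<Longrightarrow> v \<in> V \<Longrightarrow> combination V (\<lambda>w. if w = v then 1 else 0) p = p v"
  by (auto simp: combination_def if_distrib[of "\<lambda>a. a * _"] cong: if_cong)

text \<open>Expand the squared distance as \<open>A v + A w - 2 * B v w\<close>; since the weights
  sum to 0, both \<open>A\<close> terms cancel. So the length of such a combination depends only on
  the mutual distances of the points, not on their position.\<close>

lemma sum_power2_combination:
  assumes "sum c V = 0"
  shows "(\<Sum>i<k. (combination V c p i)\<^sup>2)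
    = - (\<Sum>v\<in>V. \<Sum>w\<in>V. c v * c w * (Rdist k (p v) (p w))\<^sup>2) / 2"
proof -
  define A where "A v = (\<Sum>i<k. (p v i)\<^sup>2)" for v
  define B where "B v w = (\<Sum>i<k. p v i * p w i)" for v w
  have d: "(Rdist k (p v) (p w))\<^sup>2 = A v + A w - 2 * B v w" for v w
    unfolding Rdist_power2 A_def B_def
    by (simp add: power2_diff sum.distrib sum_subtractf sum_distrib_left algebra_simps)
  have "(\<Sum>v\<in>V. \<Sum>w\<in>V. c v * c w * (Rdist k (p v) (p w))\<^sup>2)
      = (\<Sum>v\<in>V. \<Sum>w\<in>V. (c v * A v) * c w) + (\<Sum>v\<in>V. \<Sum>w\<in>V. c v * (c w * A w))
        - 2 * (\<Sum>v\<in>V. \<Sum>w\<in>V. c v * c w * B v w)"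
    by (simp add: d algebra_simps sum.distrib sum_subtractf sum_distrib_left)
  also have "(\<Sum>v\<in>V. \<Sum>w\<in>V. (c v * A v) * c w) = 0"
    by (simp add: assms flip: sum_distrib_left)
  also have "(\<Sum>v\<in>V. \<Sum>w\<in>V. c v * (c w * A w)) = 0"
    by (simp add: assms flip: sum_distrib_left sum_distrib_right)
  also have "(\<Sum>v\<in>V. \<Sum>w\<in>V. c v * c w * B v w)
      = (\<Sum>v\<in>V. \<Sum>w\<in>V. \<Sum>i<k. (c v * p v i) * (c w * p w i))"
    by (simp add: B_def sum_distrib_left algebra_simps)
  also have "\<dots> = (\<Sum>v\<in>V. \<Sum>i<k. \<Sum>w\<in>V. (c v * p v i) * (c w * p w i))"
    by (intro sum.cong refl sum.swap)
  also have "\<dots> = (\<Sum>i<k. \<Sum>v\<in>V. \<Sum>w\<in>V. (c v * p v i) * (c w * p w i))"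
    by (rule sum.swap)
  also have "\<dots> = (\<Sum>i<k. (combination V c p i)\<^sup>2)"
    by (simp add: combination_def power2_eq_square sum_product)
  finally show ?thesis by simp
qed

text \<open>The difference of two affine combinations has weights of sum 0, so its length is a
  function of the mutual distances alone.\<close>

lemma Rdist_combination_cong:
  assumes "\<And>v w. v \<in> V \<Longrightarrow> w \<in> V \<Longrightarrow> Rdist k (p v) (p w) = Rdist k (q v) (q w)"
    and "sum c V = 1" "sum d V = 1"
  shows "Rdist k (combination V c p) (combination V d p)
    = Rdist k (combination V c q) (combination V d q)"
proof -
  have diff: "combination V c r i - combination V d r i = combination V (\<lambda>v. c v - d v) r i" for r i
    by (simp add: combination_def sum_subtractf left_diff_distrib)
  have 0: "(\<Sum>v\<in>V. c v - d v) = 0"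
    using assms(2,3) by (simp add: sum_subtractf)
  show ?thesis
    unfolding Rdist_eq_iff[of k "combination V c p"] Rdist_power2[of k "combination V c _"]
      diff sum_power2_combination[OF 0]
    by (simp add: assms(1))
qed

text \<open>The isometry keeps the barycentric coordinates and replaces the frame \<open>p\<close>
  by \<open>q\<close>. Distances survive because they are computed from the weights and the mutual
  distances in the frame.\<close>

lemma isometry_between_frames:
  assumes p: "affine_frame k V p" and q: "affine_frame k V q"
    and pq: "\<And>v w. v \<in> V \<Longrightarrow> w \<in> V \<Longrightarrow> Rdist k (p v) (p w) = Rdist k (q v) (q w)"
  obtains T where "T \<in> isometries k" "\<And>v. v \<in> V \<Longrightarrow> T (p v) = q v"
proof -
  have fin: "finite V" and pV: "p \<in> V \<rightarrow> Rpow k" and qV: "q \<in> V \<rightarrow> Rpow k"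
    using p q by (auto simp: affine_frame_def)
  have "\<forall>x\<in>Rpow k. \<exists>c. sum c V = 1 \<and> x = combination V c p"
    using p by (simp add: affine_frame_def)
  then obtain b where b: "\<And>x. x \<in> Rpow k \<Longrightarrow> sum (b x) V = 1"
      "\<And>x. x \<in> Rpow k \<Longrightarrow> combination V (b x) p = x"
    by metis
  define T where "T = (\<lambda>x\<in>Rpow k. combination V (b x) q)"
  have T_in: "T x \<in> Rpow k" if "x \<in> Rpow k" for x
    using that qV by (simp add: T_def combination_in_Rpow)
  have T_comb: "T (combination V c p) = combination V c q" if c: "sum c V = 1" for c
  proof -
    let ?x = "combination V c p"
    have x: "?x \<in> Rpow k"
      using pV by (rule combination_in_Rpow)
    \<comment> \<open>Independence of the choice \<open>b\<close>: two weight vectors of the same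
      point with respect to \<open>p\<close> yield points at distance 0 with respect to
      \<open>q\<close>.\<close>
    have "Rdist k (combination V (b ?x) q) (combination V c q)
        = Rdist k (combination V (b ?x) p) (combination V c p)"
      using pq b(1)[OF x] c by (intro Rdist_combination_cong) auto
    also have "\<dots> = 0"
      by (simp add: b(2)[OF x])
    finally have "combination V (b ?x) q = combination V c q"
      by (rule Rdist_eq_0_imp_eq[OF combination_in_Rpow[OF qV] combination_in_Rpow[OF qV]])
    then show ?thesis
      using x unfolding T_def by simp
  qed
  have T_iso: "Rdist k (T x) (T y) = Rdist k x y" if "x \<in> Rpow k" "y \<in> Rpow k" for x y
  proof -
    have "Rdist k (T x) (T y) = Rdist k (combination V (b x) q) (combination V (b y) q)"
      using that by (simp add: T_def)
    also have "\<dots> = Rdist k (combination V (b x) p) (combination V (b y) p)"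
      using pq b(1) that by (intro Rdist_combination_cong) auto
    also have "\<dots> = Rdist k x y"
      using b(2) that by metis
    finally show ?thesis .
  qed
  have "inj_on T (Rpow k)"
    by (rule inj_onI) (metis T_iso Rdist_self Rdist_eq_0_imp_eq)
  moreover have "T ` Rpow k = Rpow k"
  proof
    show "T ` Rpow k \<subseteq> Rpow k"
      using T_in by blast
    show "Rpow k \<subseteq> T ` Rpow k"
    proof
      fix y assume "y \<in> Rpow k"
      then obtain c where "sum c V = 1" "y = combination V c q"
        using q unfolding affine_frame_def by blast
      then show "y \<in> T ` Rpow k"
        using T_comb combination_in_Rpow[OF pV] by (metis imageI)
    qed
  qed
  ultimately have "T \<in> isometries k"
    unfolding isometries_def Bij_def bij_betw_def using T_iso
    by (auto simp: T_def)
  moreover have "T (p v) = q v" if "v \<in> V" for v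
    using T_comb[of "\<lambda>w. if w = v then 1 else 0"] fin that by (simp add: combination_single)
  ultimately show thesis
    using that by blast
qed

text \<open>Equal distances from \<open>x\<close> and \<open>y\<close> to \<open>p v\<close> say
  that the inner product of \<open>x - y\<close> with \<open>p v\<close> has a value independent of
  \<open>v\<close>. As \<open>x - y\<close> is itself a combination of the \<open>p v\<close> with
  weights of sum 0, its inner product with itself vanishes.\<close>

lemma affine_frame_Rdist_determines:
  assumes p: "affine_frame k V p"
    and x: "x \<in> Rpow k" and y: "y \<in> Rpow k"
    and xy: "\<And>v. v \<in> V \<Longrightarrow> Rdist k x (p v) = Rdist k y (p v)"
  shows "x = y"
proof -
  obtain c d where c: "sum c V = 1" "x = combination V c p"
    and d: "sum d V = 1" "y = combination V d p"
    using p x y unfolding affine_frame_def by meson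
  have inner: "(\<Sum>i<k. (x i - y i) * p v i) = (\<Sum>i<k. (x i)\<^sup>2 - (y i)\<^sup>2) / 2" if "v \<in> V" for v
  proof -
    have "(\<Sum>i<k. (x i - p v i)\<^sup>2) = (\<Sum>i<k. (y i - p v i)\<^sup>2)"
      using xy[OF that] by (simp flip: Rdist_power2)
    then have "(\<Sum>i<k. (x i - p v i)\<^sup>2 - (y i - p v i)\<^sup>2) = 0"
      by (simp add: sum_subtractf)
    also have "(\<Sum>i<k. (x i - p v i)\<^sup>2 - (y i - p v i)\<^sup>2)
        = (\<Sum>i<k. ((x i)\<^sup>2 - (y i)\<^sup>2) - 2 * ((x i - y i) * p v i))"
      by (intro sum.cong refl) (simp add: power2_eq_square algebra_simps)
    also have "\<dots> = (\<Sum>i<k. (x i)\<^sup>2 - (y i)\<^sup>2) - 2 * (\<Sum>i<k. (x i - y i) * p v i)"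
      by (simp add: sum_subtractf sum_distrib_left)
    finally show ?thesis by simp
  qed
  have "(Rdist k x y)\<^sup>2 = (\<Sum>i<k. (x i - y i) * (\<Sum>v\<in>V. (c v - d v) * p v i))"
    unfolding Rdist_power2 c d
    by (simp add: combination_def power2_eq_square left_diff_distrib sum_subtractf)
  also have "\<dots> = (\<Sum>i<k. \<Sum>v\<in>V. (c v - d v) * ((x i - y i) * p v i))"
    by (simp add: sum_distrib_left algebra_simps)
  also have "\<dots> = (\<Sum>v\<in>V. (c v - d v) * (\<Sum>i<k. (x i - y i) * p v i))"
    by (subst sum.swap) (simp add: sum_distrib_left)
  also have "\<dots> = (\<Sum>v\<in>V. (c v - d v) * ((\<Sum>i<k. (x i)\<^sup>2 - (y i)\<^sup>2) / 2))"
    by (intro sum.cong refl arg_cong2[where f = "(*)"] inner)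
  also have "\<dots> = (sum c V - sum d V) * ((\<Sum>i<k. (x i)\<^sup>2 - (y i)\<^sup>2) / 2)"
    by (simp only: sum_subtractf flip: sum_distrib_right)
  also have "\<dots> = 0"
    using c d by simp
  finally show ?thesis
    using x y by (intro Rdist_eq_0_imp_eq) auto
qed


section \<open>Points with a prescribed Gram matrix\<close>

lemma sum_sum_insert:
  fixes f :: "'v \<Rightarrow> 'v \<Rightarrow> real"
  assumes "finite F" "a \<notin> F"
  shows "(\<Sum>v\<in>insert a F. \<Sum>w\<in>insert a F. f v w)
    = f a a + (\<Sum>v\<in>F. f a v) + (\<Sum>v\<in>F. f v a) + (\<Sum>v\<in>F. \<Sum>w\<in>F. f v w)"
  using assms by (simp add: sum.distrib)

text \<open>Cholesky factorisation: each step splits off one vertex and passes to the Schur complement.\<close>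

lemma Gram_realization:
  fixes M :: "'v \<Rightarrow> 'v \<Rightarrow> real"
  assumes "finite F"
    and "\<And>v w. v \<in> F \<Longrightarrow> w \<in> F \<Longrightarrow> M v w = M w v"
    and "\<And>c. \<exists>v\<in>F. c v \<noteq> 0 \<Longrightarrow> (\<Sum>v\<in>F. \<Sum>w\<in>F. c v * c w * M v w) > 0"
  shows "\<exists>p. p \<in> F \<rightarrow> Rpow (card F) \<and>
    (\<forall>v\<in>F. \<forall>w\<in>F. (\<Sum>i<card F. p v i * p w i) = M v w) \<and>
    (\<forall>x\<in>Rpow (card F). \<exists>c. x = combination F c p)"
  using assms
proof (induction F arbitrary: M rule: finite_induct)
  case empty
  then show ?case
    by (auto simp: Rpow_iff combination_def)
next
  case (insert a F)
  note sym = insert.prems(1) and pos = insert.prems(2)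
  let ?k = "card F"
  define s where "s = sqrt (M a a)"
  have "(\<Sum>v\<in>insert a F. \<Sum>w\<in>insert a F.
      (if v = a then 1 else 0) * (if w = a then 1 else 0) * M v w) = M a a"
  proof -
    have "v \<noteq> a" if "v \<in> F" for v
      using that insert.hyps by auto
    then show ?thesis
      using insert.hyps by (simp add: sum_sum_insert cong: sum.cong)
  qed
  then have Maa: "M a a > 0"
    using pos[of "\<lambda>v. if v = a then 1 else 0"] by simp
  then have s: "s > 0" "s * s = M a a"
    by (simp_all add: s_def)
  define N where "N v w = M v w - M v a * M w a / M a a" for v w
  have "(\<Sum>v\<in>F. \<Sum>w\<in>F. c v * c w * N v w) > 0" if c: "\<exists>v\<in>F. c v \<noteq> 0" for c
  proof -
    define t where "t = (\<Sum>v\<in>F. c v * M v a)"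
    \<comment> \<open>This value at \<open>a\<close> minimises the quadratic form of
      \<open>M\<close> over that one coordinate; the minimum is the form of \<open>N\<close> at
      \<open>c\<close>.\<close>
    define d where "d = c(a := - t / M a a)"
    have dF: "d v = c v" if "v \<in> F" for v
      using that insert.hyps by (auto simp: d_def)
    have da: "d a = - t / M a a"
      by (simp add: d_def)
    have t1: "(\<Sum>v\<in>F. d v * d a * M v a) = d a * t"
      using dF by (simp add: t_def sum_distrib_left mult.commute mult.left_commute)
    have t2: "(\<Sum>v\<in>F. d a * d v * M a v) = d a * t"
      using dF sym by (simp add: t_def sum_distrib_left mult.commute mult.left_commute)
    have t3: "(\<Sum>v\<in>F. \<Sum>w\<in>F. c v * c w * (M v a * M w a / M a a)) = t * t / M a a"
      by (simp add: t_def sum_product sum_divide_distrib algebra_simps)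
    have "0 < (\<Sum>v\<in>insert a F. \<Sum>w\<in>insert a F. d v * d w * M v w)"
      using c dF by (intro pos) auto
    also have "\<dots> = d a * d a * M a a + d a * t + d a * t + (\<Sum>v\<in>F. \<Sum>w\<in>F. c v * c w * M v w)"
      unfolding sum_sum_insert[OF insert.hyps(1,2)] t1 t2 using dF by simp
    also have "\<dots> = (\<Sum>v\<in>F. \<Sum>w\<in>F. c v * c w * M v w) - t * t / M a a"
      using Maa by (simp add: da field_simps)
    also have "\<dots> = (\<Sum>v\<in>F. \<Sum>w\<in>F. c v * c w * N v w)"
      by (simp only: N_def right_diff_distrib sum_subtractf t3)
    finally show ?thesis .
  qed
  moreover have "N v w = N w v" if "v \<in> F" "w \<in> F" for v w
    using sym that by (simp add: N_def)
  ultimately obtain p where p: "p \<in> F \<rightarrow> Rpow ?k"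
    and gram: "\<And>v w. v \<in> F \<Longrightarrow> w \<in> F \<Longrightarrow> (\<Sum>i<?k. p v i * p w i) = N v w"
    and span: "\<And>x. x \<in> Rpow ?k \<Longrightarrow> \<exists>c. x = combination F c p"
    using insert.IH[of N] by blast
  \<comment> \<open>The new axis has index \<open>?k\<close>. The vector of \<open>a\<close> lies on
    it with length \<open>s\<close>; the entry \<open>M v a / s\<close> gives every other vector the
    right inner product with it and restores what \<open>N\<close> subtracted from
    \<open>M\<close>.\<close>
  define q where "q v = (if v = a then (\<lambda>_. 0)(?k := s) else (p v)(?k := M v a / s))" for v
  have qa: "q a = (\<lambda>_. 0)(?k := s)" and qF: "\<And>v. v \<in> F \<Longrightarrow> q v = (p v)(?k := M v a / s)"
    using insert.hyps by (auto simp: q_def)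
  have card: "card (insert a F) = Suc ?k"
    using insert.hyps by simp
  have "q \<in> insert a F \<rightarrow> Rpow (Suc ?k)"
    using p by (auto simp: Pi_iff Rpow_iff q_def)
  moreover have "(\<Sum>i<Suc ?k. q v i * q w i) = M v w" if "v \<in> insert a F" "w \<in> insert a F" for v w
  proof -
    have "(\<Sum>i<?k. q v i * q w i) + q v ?k * q w ?k = M v w"
      if "v \<in> F" "w \<in> F" for v w
      using that gram s by (simp add: qF N_def)
    moreover have "(\<Sum>i<?k. q v i * q a i) + q v ?k * q a ?k = M v a" if "v \<in> F" for v
      using that s by (simp add: qF qa)
    moreover have "(\<Sum>i<?k. q a i * q v i) + q a ?k * q v ?k = M a v" if "v \<in> F" for v
      using that s sym by (simp add: qF qa)
    moreover have "(\<Sum>i<?k. q a i * q a i) + q a ?k * q a ?k = M a a"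
      using s by (simp add: qa)
    ultimately show ?thesis
      using that by auto
  qed
  moreover have "\<exists>c. x = combination (insert a F) c q" if x: "x \<in> Rpow (Suc ?k)" for x
  proof -
    have "x(?k := 0) \<in> Rpow ?k"
      using x by (auto simp: Rpow_iff Suc_le_eq)
    then obtain c where c: "x(?k := 0) = combination F c p"
      using span by blast
    \<comment> \<open>Since \<open>q a\<close> is zero off the new axis, its coefficient can be
      adjusted to correct the last coordinate without disturbing the others.\<close>
    define d where "d = c(a := (x ?k - (\<Sum>v\<in>F. c v * (M v a / s))) / s)"
    have dF: "d v = c v" if "v \<in> F" for v
      using that insert.hyps by (auto simp: d_def)
    have "x i = combination (insert a F) d q i" for i
    proof (cases "i = ?k")
      case True
      then show ?thesis
        using insert.hyps s by (simp add: combination_def dF qF qa) (simp add: d_def)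
    next
      case False
      then have "x i = combination F c p i"
        using fun_cong[OF c, of i] by simp
      then show ?thesis
        using insert.hyps False by (simp add: combination_def dF qF qa)
    qed
    then show ?thesis by blast
  qed
  ultimately show ?case
    unfolding card by blast
qed

text \<open>
  With one vertex at the origin, twice the Gram matrix of the others is the identity plus the all-ones
  matrix plus \<open>\<epsilon>\<close> times a bounded matrix, hence positive definite for small \<open>\<epsilon>\<close>.
\<close>

lemma affine_frame_near_regular_simplex:
  fixes m :: "'v \<Rightarrow> 'v \<Rightarrow> nat"
  assumes fin: "finite V" and "V \<noteq> {}"
    and sym: "\<And>v w. m v w = m w v" and bound: "\<And>v w. m v w \<le> K"
  obtains p and \<epsilon> :: real where "\<epsilon> > 0" "affine_frame (card V - 1) V p"
    "\<And>v w. v \<in> V \<Longrightarrow> w \<in> V \<Longrightarrow> v \<noteq> w \<Longrightarrow> (Rdist (card V - 1) (p v) (p w))\<^sup>2 = 1 + \<epsilon> * m v w"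
proof -
  obtain o' where o: "o' \<in> V"
    using assms(2) by blast
  define F where "F = V - {o'}"
  have F: "finite F" "o' \<notin> F" "V = insert o' F" "card V - 1 = card F"
    using fin o by (auto simp: F_def)
  let ?n = "card F"
  \<comment> \<open>The entries of the perturbation \<open>E\<close> are at most
    \<open>2 * K\<close> in absolute value, so its quadratic form is at least
    \<open>- 2 * K * ?n\<close> times the sum of squares. The summand 1 makes the product with
    \<epsilon> strictly less than 1 and keeps the denominator positive when \<open>K\<close> or
    \<open>?n\<close> is 0.\<close>
  define \<epsilon> where "\<epsilon> = 1 / (2 * real K * real ?n + 1)"
  have pos1: "2 * real K * real ?n + 1 > 0"
    by (simp add: add_nonneg_pos)
  then have \<epsilon>: "\<epsilon> > 0" "\<epsilon> * (2 * real K * real ?n) < 1"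
    by (simp_all add: \<epsilon>_def field_simps)
  \<comment> \<open>\<open>D\<close> is the desired squared distance. By polarisation,
    \<open>M\<close> is the Gram matrix forced by \<open>D\<close> when \<open>o'\<close> sits at
    the origin.\<close>
  define D where "D v w = (if v = w then 0 else 1 + \<epsilon> * m v w)" for v w
  define M where "M v w = (D v o' + D w o' - D v w) / 2" for v w
  \<comment> \<open>The case distinction mirrors \<open>D\<close>, which is 0 on the diagonal
    whatever the value of \<open>m v v\<close>.\<close>
  define E where "E v w = real (m v o') + real (m w o') - (if v = w then 0 else real (m v w))" for v w
  have E: "\<bar>E v w\<bar> \<le> 2 * real K" for v w
    using bound[of v o'] bound[of w o'] bound[of v w] by (auto simp: E_def)
  have ME: "M v w = ((if v = w then 1 else 0) + 1 + \<epsilon> * E v w) / 2" if "v \<in> F" "w \<in> F" for v w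
    using that F by (auto simp: M_def D_def E_def field_simps)
  have "(\<Sum>v\<in>F. \<Sum>w\<in>F. c v * c w * M v w) > 0" if c: "\<exists>v\<in>F. c v \<noteq> 0" for c
  proof -
    define S where "S = (\<Sum>v\<in>F. (c v)\<^sup>2)"
    have S: "S > 0"
    proof -
      obtain v where "v \<in> F" "c v \<noteq> 0"
        using c by blast
      then show ?thesis
        unfolding S_def using F(1) by (intro sum_pos2[of F v]) auto
    qed
    have "(\<Sum>v\<in>F. \<Sum>w\<in>F. c v * c w * M v w)
        = (\<Sum>v\<in>F. \<Sum>w\<in>F. ((if v = w then c v * c w else 0) + c v * c w + \<epsilon> * (c v * c w * E v w)) / 2)"
      by (intro sum.cong refl) (auto simp: ME algebra_simps)
    also have "\<dots> = (S + (\<Sum>v\<in>F. c v)\<^sup>2 + \<epsilon> * (\<Sum>v\<in>F. \<Sum>w\<in>F. c v * c w * E v w)) / 2"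
    proof -
      have "(\<Sum>v\<in>F. c v)\<^sup>2 = (\<Sum>v\<in>F. \<Sum>w\<in>F. c v * c w)"
        by (simp add: power2_eq_square sum_product)
      moreover have "S = (\<Sum>v\<in>F. \<Sum>w\<in>F. if v = w then c v * c w else 0)"
        using F(1) by (simp add: S_def power2_eq_square)
      ultimately show ?thesis
        by (simp only: sum.distrib sum_distrib_left flip: sum_divide_distrib)
    qed
    finally have eq: "(\<Sum>v\<in>F. \<Sum>w\<in>F. c v * c w * M v w)
      = (S + (\<Sum>v\<in>F. c v)\<^sup>2 + \<epsilon> * (\<Sum>v\<in>F. \<Sum>w\<in>F. c v * c w * E v w)) / 2" .
    \<comment> \<open>The bound is \<open>2 * \<bar>x * y\<bar> \<le> x * x + y * y\<close>; it is
      linear in the squares, so summing over all pairs gives a multiple of \<open>S\<close>.\<close>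
    have "- (c v * c w * E v w) \<le> real K * ((c v)\<^sup>2 + (c w)\<^sup>2)" for v w
    proof -
      have "- (c v * c w * E v w) \<le> \<bar>c v * c w\<bar> * \<bar>E v w\<bar>"
        by (metis abs_ge_minus_self abs_mult)
      also have "\<dots> \<le> \<bar>c v * c w\<bar> * (2 * real K)"
        using E by (intro mult_left_mono) auto
      also have "\<dots> = real K * (2 * \<bar>c v\<bar> * \<bar>c w\<bar>)"
        by (simp add: abs_mult)
      also have "\<dots> \<le> real K * ((c v)\<^sup>2 + (c w)\<^sup>2)"
        using sum_squares_bound[of "\<bar>c v\<bar>" "\<bar>c w\<bar>"] by (intro mult_left_mono) auto
      finally show ?thesis .
    qed
    then have "(\<Sum>v\<in>F. \<Sum>w\<in>F. - (c v * c w * E v w)) \<le> (\<Sum>v\<in>F. \<Sum>w\<in>F. real K * ((c v)\<^sup>2 + (c w)\<^sup>2))"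
      by (intro sum_mono)
    also have "\<dots> = 2 * real K * real ?n * S"
      by (simp add: S_def sum.distrib sum_distrib_left algebra_simps)
    finally have "- (\<Sum>v\<in>F. \<Sum>w\<in>F. c v * c w * E v w) \<le> 2 * real K * real ?n * S"
      by (simp add: sum_negf)
    then have "\<epsilon> * - (\<Sum>v\<in>F. \<Sum>w\<in>F. c v * c w * E v w) \<le> \<epsilon> * (2 * real K * real ?n) * S"
      using \<epsilon>(1) by (simp only: mult.assoc mult_left_mono less_imp_le)
    also have "\<dots> < S"
      using \<epsilon>(2) S by simp
    finally have "0 < S + \<epsilon> * (\<Sum>v\<in>F. \<Sum>w\<in>F. c v * c w * E v w)"
      by simp
    \<comment> \<open>The all-ones matrix contributes the square of the sum of the weights, which
      can only increase the form.\<close>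
    moreover have pos_half: "0 < (S + r + x) / 2" if "0 < S + x" "0 \<le> r" for r x
      using that by simp
    ultimately show ?thesis
      unfolding eq by (intro pos_half zero_le_power2)
  qed
  moreover have "M v w = M w v" for v w
    using sym by (simp add: M_def D_def)
  ultimately obtain p where p: "p \<in> F \<rightarrow> Rpow ?n"
    and gram: "\<And>v w. v \<in> F \<Longrightarrow> w \<in> F \<Longrightarrow> (\<Sum>i<?n. p v i * p w i) = M v w"
    and span: "\<And>x. x \<in> Rpow ?n \<Longrightarrow> \<exists>c. x = combination F c p"
    using Gram_realization[OF F(1), of M] by blast
  define q where "q = p(o' := \<lambda>_. 0)"
  have qo: "q o' = (\<lambda>_. 0)" and qF: "\<And>v. v \<in> F \<Longrightarrow> q v = p v"
    using F by (auto simp: q_def)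
  have "affine_frame ?n V q"
    unfolding affine_frame_def
  proof (intro conjI ballI fin)
    show "q \<in> V \<rightarrow> Rpow ?n"
      using p F by (auto simp: Pi_iff Rpow_iff q_def)
    fix x assume "x \<in> Rpow ?n"
    then obtain c where c: "x = combination F c p"
      using span by blast
    \<comment> \<open>Linear spanning becomes affine spanning: the origin \<open>q o'\<close>
      absorbs the missing weight without moving the point.\<close>
    define d where "d = c(o' := 1 - sum c F)"
    have dF: "d v = c v" if "v \<in> F" for v
      using that F by (auto simp: d_def)
    have "sum d V = 1"
      using F dF by (simp add: d_def)
    moreover have "x = combination V d q"
      unfolding c using F by (simp add: combination_def qo qF dF)
    ultimately show "\<exists>c. sum c V = 1 \<and> x = combination V c q"
      by blast
  qed
  moreover have "(Rdist ?n (q v) (q w))\<^sup>2 = 1 + \<epsilon> * m v w" if "v \<in> V" "w \<in> V" "v \<noteq> w" for v w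
  proof -
    \<comment> \<open>The Gram identity extends to \<open>o'\<close>, since \<open>M\<close>
      vanishes as soon as one argument is \<open>o'\<close>.\<close>
    have gram': "(\<Sum>i<?n. q v i * q w i) = M v w" if "v \<in> V" "w \<in> V" for v w
      using that gram F by (auto simp: qo qF M_def D_def sym)
    have "(Rdist ?n (q v) (q w))\<^sup>2 = M v v + M w w - 2 * M v w"
      unfolding Rdist_power2 using gram' that(1,2)
      by (simp add: power2_eq_square sum.distrib sum_subtractf algebra_simps flip: sum_distrib_left)
    also have "\<dots> = D v w"
      by (simp add: M_def D_def[of v v] D_def[of w w] field_simps)
    finally show ?thesis
      using that by (simp add: D_def)
  qed
  ultimately show thesis
    using that[OF \<epsilon>(1)] unfolding F(4) by blast
qed


section \<open>The two groups\<close>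

lemma edge_mult_commute: "edge_mult G x y = edge_mult G y x"
  by (simp add: edge_mult_def insert_commute)

text \<open>Isometries preserving the points correspond to permutations preserving
  \<open>edge_mult\<close>. The distance hypothesis compares a pair of equal vertices only with
  another such pair: two nonadjacent vertices may have the same multiplicity 0 as a vertex with
  itself, yet their points are distinct.\<close>

lemma regular_embeddingI:
  assumes p: "affine_frame k (verts G) p" and inj: "inj_on p (verts G)"
    and dist: "\<And>v w x y. \<lbrakk>v \<in> verts G; w \<in> verts G; x \<in> verts G; y \<in> verts G; v = w \<longleftrightarrow> x = y\<rbrakk> \<Longrightarrow>
      Rdist k (p v) (p w) = Rdist k (p x) (p y) \<longleftrightarrow> edge_mult G v w = edge_mult G x y"
  shows "regular_embedding G k p"
proof -
  let ?V = "verts G"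
  let ?H = "setwise_isometry_group k (p ` ?V)"
  have fin: "finite ?V" and pV: "p \<in> ?V \<rightarrow> Rpow k"
    using p by (auto simp: affine_frame_def)
  have pV': "p v \<in> Rpow k" if "v \<in> ?V" for v
    using pV that by (rule funcset_mem)
  have carrier_H: "carrier ?H = {g \<in> isometries k. g ` p ` ?V = p ` ?V}"
    by (simp add: setwise_isometry_group_def)
  have carrier_A: "carrier (Aut G) =
      {g \<in> Bij ?V. \<forall>x\<in>?V. \<forall>y\<in>?V. edge_mult G (g x) (g y) = edge_mult G x y}"
    by (simp add: Aut_def)
  \<comment> \<open>The permutation of the vertices induced by \<open>g\<close>, transported along
    \<open>p\<close>. This direction needs no choice; extending a permutation to an isometry is left
    to surjectivity.\<close>
  define \<Phi> where "\<Phi> g = (\<lambda>v\<in>?V. inv_into ?V p (g (p v)))" for g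
  have \<Phi>: "\<Phi> g v \<in> ?V" "p (\<Phi> g v) = g (p v)" if "g \<in> carrier ?H" "v \<in> ?V" for g v
  proof -
    have "g (p v) \<in> p ` ?V"
      using that unfolding carrier_H by blast
    then show "\<Phi> g v \<in> ?V" "p (\<Phi> g v) = g (p v)"
      using that(2) by (auto simp: \<Phi>_def inv_into_into f_inv_into_f)
  qed
  have iso: "g \<in> Bij (Rpow k)"
      "\<And>x y. x \<in> Rpow k \<Longrightarrow> y \<in> Rpow k \<Longrightarrow> Rdist k (g x) (g y) = Rdist k x y"
    if "g \<in> carrier ?H" for g
    using that by (auto simp: carrier_H isometries_def)
  have \<Phi>_inj: "\<Phi> g v = \<Phi> g w \<longleftrightarrow> v = w" if g: "g \<in> carrier ?H" and vw: "v \<in> ?V" "w \<in> ?V" for g v w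
  proof
    assume "\<Phi> g v = \<Phi> g w"
    then have "g (p v) = g (p w)"
      using \<Phi>(2) g vw by metis
    then have "p v = p w"
      using iso(1)[OF g] pV' vw by (auto simp: Bij_def bij_betw_def dest: inj_onD)
    then show "v = w"
      using inj vw by (auto dest: inj_onD)
  qed auto
  have \<Phi>_Aut: "\<Phi> g \<in> carrier (Aut G)" if g: "g \<in> carrier ?H" for g
  proof -
    have "inj_on (\<Phi> g) ?V"
      using \<Phi>_inj[OF g] by (auto intro: inj_onI)
    moreover have "\<Phi> g ` ?V \<subseteq> ?V"
      using \<Phi>(1)[OF g] by blast
    ultimately have "\<Phi> g \<in> Bij ?V"
      using fin by (auto simp: Bij_def bij_betw_def endo_inj_surj \<Phi>_def)
    moreover have "edge_mult G (\<Phi> g v) (\<Phi> g w) = edge_mult G v w" if "v \<in> ?V" "w \<in> ?V" for v w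
      using dist[of "\<Phi> g v" "\<Phi> g w" v w] \<Phi>[OF g] \<Phi>_inj[OF g that] iso(2)[OF g] pV' that
      by simp
    ultimately show ?thesis
      by (simp add: carrier_A)
  qed
  have "\<Phi> \<in> hom ?H (Aut G)"
  proof (rule homI)
    fix g h assume g: "g \<in> carrier ?H" and h: "h \<in> carrier ?H"
    have "\<Phi> (compose (Rpow k) g h) = compose ?V (\<Phi> g) (\<Phi> h)"
    proof
      fix v
      show "\<Phi> (compose (Rpow k) g h) v = compose ?V (\<Phi> g) (\<Phi> h) v"
      proof (cases "v \<in> ?V")
        case True
        have "compose ?V (\<Phi> g) (\<Phi> h) v = \<Phi> g (\<Phi> h v)"
          using True by (simp add: compose_eq)
        also have "\<dots> = inv_into ?V p (g (p (\<Phi> h v)))"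
          using \<Phi>(1)[OF h True] by (simp add: \<Phi>_def[of g])
        also have "\<dots> = inv_into ?V p (g (h (p v)))"
          using \<Phi>(2)[OF h True] by simp
        also have "\<dots> = \<Phi> (compose (Rpow k) g h) v"
          using True pV'[OF True] by (simp add: \<Phi>_def compose_eq)
        finally show ?thesis ..
      qed (simp add: \<Phi>_def compose_def)
    qed
    moreover have "\<Phi> g \<in> Bij ?V" "\<Phi> h \<in> Bij ?V"
      using \<Phi>_Aut g h by (auto simp: carrier_A)
    ultimately show "\<Phi> (g \<otimes>\<^bsub>?H\<^esub> h) = \<Phi> g \<otimes>\<^bsub>Aut G\<^esub> \<Phi> h"
      using iso(1)[OF g] iso(1)[OF h]
      by (simp add: setwise_isometry_group_def Aut_def BijGroup_def)
  qed (rule \<Phi>_Aut)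
  moreover have "inj_on \<Phi> (carrier ?H)"
  proof (rule inj_onI)
    fix g h assume g: "g \<in> carrier ?H" and h: "h \<in> carrier ?H" and eq: "\<Phi> g = \<Phi> h"
    have gh: "g (p v) = h (p v)" if "v \<in> ?V" for v
      using \<Phi>(2)[OF g that] \<Phi>(2)[OF h that] eq by simp
    show "g = h"
    proof (rule extensionalityI[of _ "Rpow k"])
      show "g \<in> extensional (Rpow k)" "h \<in> extensional (Rpow k)"
        using iso(1) g h by (auto simp: Bij_def)
      fix x assume x: "x \<in> Rpow k"
      show "g x = h x"
      proof (rule affine_frame_Rdist_determines[OF p])
        show "g x \<in> Rpow k" "h x \<in> Rpow k"
          by (rule Bij_mem[OF iso(1)[OF g] x], rule Bij_mem[OF iso(1)[OF h] x])
        fix v assume "v \<in> ?V"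
        \<comment> \<open>Every frame point is an image \<open>g (p w) = h (p w)\<close>, so
          \<open>g x\<close> and \<open>h x\<close> both have from it the distance of
          \<open>x\<close> from \<open>p w\<close>. Hence they coincide, and neither linearity nor
          affinity of isometries has to be invoked.\<close>
        then obtain w where w: "w \<in> ?V" "p v = g (p w)"
          using g unfolding carrier_H by blast
        show "Rdist k (g x) (p v) = Rdist k (h x) (p v)"
          using iso(2)[OF g x pV'[OF w(1)]] iso(2)[OF h x pV'[OF w(1)]] gh[OF w(1)] w(2) by simp
      qed
    qed
  qed
  moreover have "\<Phi> ` carrier ?H = carrier (Aut G)"
  proof
    show "\<Phi> ` carrier ?H \<subseteq> carrier (Aut G)"
      using \<Phi>_Aut by blast
    show "carrier (Aut G) \<subseteq> \<Phi> ` carrier ?H"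
    proof
      fix a assume a: "a \<in> carrier (Aut G)"
      then have bij: "bij_betw a ?V ?V" and ext: "a \<in> extensional ?V"
        by (auto simp: carrier_A Bij_def)
      have aV: "a v \<in> ?V" if "v \<in> ?V" for v
        using bij that by (rule bij_betw_apply)
      \<comment> \<open>Permuting the points by \<open>a\<close> keeps the frame, with the weights
        permuted alike. The isometry from the old frame to the permuted one realises
        \<open>a\<close>.\<close>
      have "affine_frame k ?V (\<lambda>v. p (a v))"
        unfolding affine_frame_def
      proof (intro conjI ballI fin)
        show "(\<lambda>v. p (a v)) \<in> ?V \<rightarrow> Rpow k"
          using aV pV' by blast
        fix x assume "x \<in> Rpow k"
        then obtain c where "sum c ?V = 1" "x = combination ?V c p"
          using p unfolding affine_frame_def by blast
        then have "sum (\<lambda>v. c (a v)) ?V = 1 \<and> x = combination ?V (\<lambda>v. c (a v)) (\<lambda>v. p (a v))"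
          by (simp add: combination_def sum.reindex_bij_betw[OF bij]
              sum.reindex_bij_betw[OF bij, of "\<lambda>v. c v * p v _"])
        then show "\<exists>c. sum c ?V = 1 \<and> x = combination ?V c (\<lambda>v. p (a v))"
          by blast
      qed
      moreover have "Rdist k (p v) (p w) = Rdist k (p (a v)) (p (a w))"
        if "v \<in> ?V" "w \<in> ?V" for v w
      proof -
        have "v = w \<longleftrightarrow> a v = a w"
          using bij that by (auto simp: bij_betw_def dest: inj_onD)
        moreover have "edge_mult G (a v) (a w) = edge_mult G v w"
          using a that by (simp add: carrier_A)
        ultimately show ?thesis
          using dist[of v w "a v" "a w"] that aV by simp
      qed
      ultimately obtain T where T: "T \<in> isometries k" "\<And>v. v \<in> ?V \<Longrightarrow> T (p v) = p (a v)"
        using isometry_between_frames[OF p, of "\<lambda>v. p (a v)"] by blast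
      have "T ` p ` ?V = (\<lambda>v. p (a v)) ` ?V"
        unfolding image_image using T(2) by (intro image_cong) auto
      also have "\<dots> = p ` ?V"
        using bij by (auto simp: bij_betw_def simp flip: image_image)
      finally have "T \<in> carrier ?H"
        using T(1) by (simp add: carrier_H)
      moreover have "\<Phi> T = a"
      proof (rule extensionalityI[of _ ?V])
        show "\<Phi> T v = a v" if "v \<in> ?V" for v
          using that T(2) inj aV by (simp add: \<Phi>_def inv_into_f_f)
      qed (use ext in \<open>simp_all add: \<Phi>_def\<close>)
      ultimately show "a \<in> \<Phi> ` carrier ?H"
        by blast
    qed
  qed
  ultimately have "?H \<cong> Aut G"
    by (intro is_isoI[of \<Phi>] isoI) (auto simp: bij_betw_def)
  moreover have "p ` ?V \<subseteq> Rpow k"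
    using pV' by blast
  ultimately have "Aut G \<cong> ?H"
    using group.iso_sym[OF group_setwise_isometry_group] by blast
  then show ?thesis
    using pV by (simp add: regular_embedding_def)
qed

text \<open>A separate case because no affine frame is indexed by the empty set: an empty sum of
  weights is 0, never 1. In dimension 0 both groups are trivial.\<close>

lemma regular_embedding_no_verts:
  fixes G :: "('v, 'e) multigraph"
  assumes "verts G = {}"
  shows "regular_embedding G 0 f"
proof -
  let ?H = "setwise_isometry_group 0 (f ` verts G)"
  have "Rpow 0 = {\<lambda>_. 0}"
    by (auto simp: Rpow_iff)
  then have H: "g = h" if "g \<in> carrier ?H" "h \<in> carrier ?H" for g h
    using that by (auto simp: setwise_isometry_group_def isometries_def Bij_def bij_betw_def
        intro!: extensionalityI[of g "Rpow 0" h])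
  have A: "g = h" if "g \<in> carrier (Aut G)" "h \<in> carrier (Aut G)" for g h
    using that assms by (auto simp: Aut_def Bij_def)
  interpret A: group "Aut G" by (rule group_Aut)
  interpret H: group ?H by (rule group_setwise_isometry_group) (simp add: assms)
  have "carrier (Aut G) = {\<one>\<^bsub>Aut G\<^esub>}" "carrier ?H = {\<one>\<^bsub>?H\<^esub>}"
    using A H A.one_closed H.one_closed by blast+
  then have "Aut G \<cong> ?H"
    by (intro is_isoI[of "\<lambda>_. \<one>\<^bsub>?H\<^esub>"] isoI homI) (auto simp: bij_betw_def)
  then show ?thesis
    using assms by (simp add: regular_embedding_def)
qed

theorem mainTheorem10:
  fixes G :: "('v, 'e) multigraph"
  assumes "finite_multigraph G" and "loopless G" and "irreducible_multigraph G"
  shows "\<exists>k f. regular_embedding G k f"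
proof (cases "verts G = {}")
  case True
  then show ?thesis
    using regular_embedding_no_verts by blast
next
  case False
  interpret finite_multigraph G by (rule assms(1))
  let ?k = "card (verts G) - 1"
  \<comment> \<open>A uniform bound on the multiplicities, which controls how small the perturbation
    must be.\<close>
  have "edge_mult G v w \<le> card (edges G)" for v w
    unfolding edge_mult_def by (intro card_mono finite_edges) auto
  then obtain p and \<epsilon> :: real where \<epsilon>: "\<epsilon> > 0" and p: "affine_frame ?k (verts G) p"
    and dist: "\<And>v w. v \<in> verts G \<Longrightarrow> w \<in> verts G \<Longrightarrow> v \<noteq> w \<Longrightarrow>
      (Rdist ?k (p v) (p w))\<^sup>2 = 1 + \<epsilon> * edge_mult G v w"
    using affine_frame_near_regular_simplex[OF finite_verts False, of "edge_mult G"]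
      edge_mult_commute[of G] by metis
  \<comment> \<open>Makes the multiplicities agree on any two diagonal pairs, whose distances are
    both 0.\<close>
  have loop: "edge_mult G v v = 0" for v
    using assms(2) by (auto simp: edge_mult_def loopless_def intro!: card_eq_0_iff[THEN iffD2])
  have "inj_on p (verts G)"
  proof (rule inj_onI, rule ccontr)
    fix v w assume vw: "v \<in> verts G" "w \<in> verts G" "p v = p w" "v \<noteq> w"
    then have "0 = 1 + \<epsilon> * edge_mult G v w"
      using dist[of v w] by simp
    moreover have "\<epsilon> * edge_mult G v w \<ge> 0"
      using \<epsilon> by simp
    ultimately show False by linarith
  qed
  moreover have "Rdist ?k (p v) (p w) = Rdist ?k (p x) (p y) \<longleftrightarrow> edge_mult G v w = edge_mult G x y"
    if "v \<in> verts G" "w \<in> verts G" "x \<in> verts G" "y \<in> verts G" "v = w \<longleftrightarrow> x = y" for v w x y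
    \<comment> \<open>Off the diagonal, squared distances are
      \<open>1 + \<epsilon> * edge_mult\<close>, and \<epsilon> is nonzero, so distance and
      multiplicity determine each other.\<close>
    using that dist[of v w] dist[of x y] \<epsilon> by (cases "v = w") (auto simp: loop Rdist_eq_iff)
  ultimately show ?thesis
    using regular_embeddingI[OF p] by blast
qed

end
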